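(* Let $K$ be a commutative ring with unit. Suppose that $P^{\mathrm{Lie}}(X_1,\ldots,X_n)\in\mathrm F_K^{\mathrm{Lie}}[X_1,\ldots,X_n]$ is of homogeneity degree $h$ (in its variables jointly), and that it expands in the commutator evaluation to the noncommutative polynomial \[P^{\mathrm{assoc}}(X_1,\ldots,X_n)=\sum_s a_s X_{i_{s,1}}\cdots X_{i_{s,h}}\qquad (a_s\in K).\] Then, in $\mathrm F_K^{\mathrm{Lie}}[X_1,\ldots,X_n]$, \[h(h-1)\cdot P^{\mathrm{Lie}}(X_1,\ldots,X_n)=\sum_s\sum_{p=1}^{h-1}a_s\,\bigl[[X_{i_{s,1}},\ldots,X_{i_{s,p}}]_{\mathrm L},\,[X_{i_{s,p+1}},\ldots,X_{i_{s,h}}]_{\mathrm R}\bigr].\]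
   Context: $\mathrm F_K^{\mathrm{Lie}}[X_1,\ldots,X_n]$ is the free Lie $K$-algebra on $X_1,\ldots,X_n$ and $\mathrm F_K[X_1,\ldots,X_n]$ is the free associative unital $K$-algebra. The commutator evaluation is the Lie algebra homomorphism $\mathrm F_K^{\mathrm{Lie}}[X_1,\ldots,X_n]\to \mathrm F_K[X_1,\ldots,X_n]$, $X_i\mapsto X_i$, where the target carries the bracket $ab-ba$. Iterated commutators: $[Y_1,\ldots,Y_p]_{\mathrm L}=[Y_1,[Y_2,\ldots,[Y_{p-1},Y_p]\ldots]]$ and $[Y_1,\ldots,Y_p]_{\mathrm R}=[[\ldots[Y_1,Y_2],\ldots,Y_{p-1}],Y_p]$, with $[Y_1]_{\mathrm L}=[Y_1]_{\mathrm R}=Y_1$. *)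

theory Defs
  imports Complex_Main "HOL-Library.Poly_Mapping"
begin

section \<open>Lie algebras over a commutative ring\<close>

text \<open>The bracket is required to be alternating, not merely antisymmetric, since the ground ring
  is arbitrary and 2 may fail to be cancellable.\<close>

locale lie_algebra = module scale
  for scale :: "'k::comm_ring_1 \<Rightarrow> 'b::ab_group_add \<Rightarrow> 'b" +
  fixes bracket :: "'b \<Rightarrow> 'b \<Rightarrow> 'b"
  assumes bracket_add_left: "bracket (x + y) z = bracket x z + bracket y z"
    and bracket_add_right: "bracket x (y + z) = bracket x y + bracket x z"
    and bracket_scale_left: "bracket (scale c x) y = scale c (bracket x y)"
    and bracket_scale_right: "bracket x (scale c y) = scale c (bracket x y)"
    and bracket_self: "bracket x x = 0"
    and jacobi: "bracket x (bracket y z) + bracket y (bracket z x) + bracket z (bracket x y) = 0"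


section \<open>The free Lie algebra\<close>

text \<open>Formal Lie algebra expressions in generators of type \<open>'x\<close>, modulo the least congruence
  containing the Lie algebra axioms.\<close>

datatype ('k, 'x) lie_term =
    LVar 'x
  | LZero
  | LAdd "('k, 'x) lie_term" "('k, 'x) lie_term"
  | LNeg "('k, 'x) lie_term"
  | LScale 'k "('k, 'x) lie_term"
  | LBracket "('k, 'x) lie_term" "('k, 'x) lie_term"

inductive lie_eq :: "('k::comm_ring_1, 'x) lie_term \<Rightarrow> ('k, 'x) lie_term \<Rightarrow> bool" where
  refl: "lie_eq t t"
| sym: "lie_eq s t \<Longrightarrow> lie_eq t s"
| trans: "lie_eq s t \<Longrightarrow> lie_eq t u \<Longrightarrow> lie_eq s u"
| cong_add: "lie_eq s s' \<Longrightarrow> lie_eq t t' \<Longrightarrow> lie_eq (LAdd s t) (LAdd s' t')"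
| cong_neg: "lie_eq s s' \<Longrightarrow> lie_eq (LNeg s) (LNeg s')"
| cong_scale: "lie_eq s s' \<Longrightarrow> lie_eq (LScale c s) (LScale c s')"
| cong_bracket: "lie_eq s s' \<Longrightarrow> lie_eq t t' \<Longrightarrow> lie_eq (LBracket s t) (LBracket s' t')"
| add_assoc: "lie_eq (LAdd (LAdd s t) u) (LAdd s (LAdd t u))"
| add_commute: "lie_eq (LAdd s t) (LAdd t s)"
| add_zero: "lie_eq (LAdd LZero t) t"
| add_neg: "lie_eq (LAdd (LNeg t) t) LZero"
| scale_add_right: "lie_eq (LScale c (LAdd s t)) (LAdd (LScale c s) (LScale c t))"
| scale_add_left: "lie_eq (LScale (c + d) t) (LAdd (LScale c t) (LScale d t))"
| scale_scale: "lie_eq (LScale c (LScale d t)) (LScale (c * d) t)"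
| scale_one: "lie_eq (LScale 1 t) t"
| bracket_add_left: "lie_eq (LBracket (LAdd s t) u) (LAdd (LBracket s u) (LBracket t u))"
| bracket_add_right: "lie_eq (LBracket s (LAdd t u)) (LAdd (LBracket s t) (LBracket s u))"
| bracket_scale_left: "lie_eq (LBracket (LScale c s) t) (LScale c (LBracket s t))"
| bracket_scale_right: "lie_eq (LBracket s (LScale c t)) (LScale c (LBracket s t))"
| bracket_self: "lie_eq (LBracket t t) LZero"
| jacobi: "lie_eq (LAdd (LAdd (LBracket s (LBracket t u)) (LBracket t (LBracket u s)))
                        (LBracket u (LBracket s t))) LZero"

quotient_type (overloaded) ('k, 'x) free_lie = "('k::comm_ring_1, 'x) lie_term" / lie_eq
  by (rule equivpI)
    (auto intro!: reflpI sympI transpI intro: lie_eq.refl lie_eq.sym lie_eq.trans)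

instantiation free_lie :: (comm_ring_1, type) ab_group_add
begin

lift_definition zero_free_lie :: "('a, 'b) free_lie" is LZero .

lift_definition plus_free_lie :: "('a, 'b) free_lie \<Rightarrow> ('a, 'b) free_lie \<Rightarrow> ('a, 'b) free_lie"
  is LAdd by (rule lie_eq.cong_add)

lift_definition uminus_free_lie :: "('a, 'b) free_lie \<Rightarrow> ('a, 'b) free_lie"
  is LNeg by (rule lie_eq.cong_neg)

definition minus_free_lie :: "('a, 'b) free_lie \<Rightarrow> ('a, 'b) free_lie \<Rightarrow> ('a, 'b) free_lie"
  where "minus_free_lie x y = x + - y"

instance
proof
  fix x y z :: "('a, 'b) free_lie"
  show "x + y + z = x + (y + z)" by transfer (rule lie_eq.add_assoc)
  show "x + y = y + x" by transfer (rule lie_eq.add_commute)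
  show "0 + x = x" by transfer (rule lie_eq.add_zero)
  show "- x + x = 0" by transfer (rule lie_eq.add_neg)
  show "x - y = x + - y" by (rule minus_free_lie_def)
qed

end

lift_definition lie_var :: "'x \<Rightarrow> ('k::comm_ring_1, 'x) free_lie" is LVar .

lift_definition lie_scale :: "'k::comm_ring_1 \<Rightarrow> ('k, 'x) free_lie \<Rightarrow> ('k, 'x) free_lie"
  is LScale by (rule lie_eq.cong_scale)

lift_definition lie_bracket ::
  "('k::comm_ring_1, 'x) free_lie \<Rightarrow> ('k, 'x) free_lie \<Rightarrow> ('k, 'x) free_lie"
  is LBracket by (rule lie_eq.cong_bracket)

interpretation free_lie: lie_algebra lie_scale lie_bracket
proof unfold_locales
  fix c d :: "'k::comm_ring_1" and x y z :: "('k, 'x) free_lie"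
  show "lie_scale c (x + y) = lie_scale c x + lie_scale c y"
    by transfer (rule lie_eq.scale_add_right)
  show "lie_scale (c + d) x = lie_scale c x + lie_scale d x"
    by transfer (rule lie_eq.scale_add_left)
  show "lie_scale c (lie_scale d x) = lie_scale (c * d) x"
    by transfer (rule lie_eq.scale_scale)
  show "lie_scale 1 x = x"
    by transfer (rule lie_eq.scale_one)
  show "lie_bracket (x + y) z = lie_bracket x z + lie_bracket y z"
    by transfer (rule lie_eq.bracket_add_left)
  show "lie_bracket x (y + z) = lie_bracket x y + lie_bracket x z"
    by transfer (rule lie_eq.bracket_add_right)
  show "lie_bracket (lie_scale c x) y = lie_scale c (lie_bracket x y)"
    by transfer (rule lie_eq.bracket_scale_left)
  show "lie_bracket x (lie_scale c y) = lie_scale c (lie_bracket x y)"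
    by transfer (rule lie_eq.bracket_scale_right)
  show "lie_bracket x x = 0"
    by transfer (rule lie_eq.bracket_self)
  show "lie_bracket x (lie_bracket y z) + lie_bracket y (lie_bracket z x)
          + lie_bracket z (lie_bracket x y) = 0"
    by transfer (rule lie_eq.jacobi)
qed


subsection \<open>Universal property\<close>

primrec lie_term_eval ::
  "('k \<Rightarrow> 'b::ab_group_add \<Rightarrow> 'b) \<Rightarrow> ('b \<Rightarrow> 'b \<Rightarrow> 'b) \<Rightarrow> ('x \<Rightarrow> 'b) \<Rightarrow> ('k, 'x) lie_term \<Rightarrow> 'b"
where
  "lie_term_eval sc br f (LVar x) = f x"
| "lie_term_eval sc br f LZero = 0"
| "lie_term_eval sc br f (LAdd s t) = lie_term_eval sc br f s + lie_term_eval sc br f t"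
| "lie_term_eval sc br f (LNeg t) = - lie_term_eval sc br f t"
| "lie_term_eval sc br f (LScale c t) = sc c (lie_term_eval sc br f t)"
| "lie_term_eval sc br f (LBracket s t) = br (lie_term_eval sc br f s) (lie_term_eval sc br f t)"

text \<open>The value on an equivalence class is read off a representative. When the target is a Lie
  algebra it does not depend on the representative, and the result is the unique homomorphism
  extending \<open>f\<close>, as shown next.\<close>

definition free_lie_lift ::
  "('k::comm_ring_1 \<Rightarrow> 'b::ab_group_add \<Rightarrow> 'b) \<Rightarrow> ('b \<Rightarrow> 'b \<Rightarrow> 'b) \<Rightarrow> ('x \<Rightarrow> 'b)
    \<Rightarrow> ('k, 'x) free_lie \<Rightarrow> 'b"
  where "free_lie_lift sc br f P = lie_term_eval sc br f (rep_free_lie P)"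

context lie_algebra
begin

lemma lie_term_eval_cong:
  "lie_eq s t \<Longrightarrow> lie_term_eval scale bracket f s = lie_term_eval scale bracket f t"
  by (induction rule: lie_eq.induct)
    (simp_all add: scale_right_distrib scale_left_distrib bracket_add_left bracket_add_right
      bracket_scale_left bracket_scale_right bracket_self jacobi[unfolded add.assoc] ac_simps)

lemma free_lie_lift_abs:
  "free_lie_lift scale bracket f (abs_free_lie t) = lie_term_eval scale bracket f t"
  unfolding free_lie_lift_def
  by (rule lie_term_eval_cong)
    (rule Quotient3_rep_abs[OF Quotient3_free_lie], rule lie_eq.refl)

lemma free_lie_lift_var: "free_lie_lift scale bracket f (lie_var x) = f x"
  by (simp add: lie_var.abs_eq free_lie_lift_abs)

lemma free_lie_lift_add:
  "free_lie_lift scale bracket f (P + Q)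
     = free_lie_lift scale bracket f P + free_lie_lift scale bracket f Q"
  by (induction P; induction Q) (simp add: plus_free_lie.abs_eq free_lie_lift_abs)

lemma free_lie_lift_scale:
  "free_lie_lift scale bracket f (lie_scale c P) = scale c (free_lie_lift scale bracket f P)"
  by (induction P) (simp add: lie_scale.abs_eq free_lie_lift_abs)

lemma free_lie_lift_bracket:
  "free_lie_lift scale bracket f (lie_bracket P Q)
     = bracket (free_lie_lift scale bracket f P) (free_lie_lift scale bracket f Q)"
  by (induction P; induction Q) (simp add: lie_bracket.abs_eq free_lie_lift_abs)

lemma free_lie_lift_unique:
  assumes var: "\<And>x. g (lie_var x) = f x"
    and add: "\<And>P Q. g (P + Q) = g P + g Q"
    and scl: "\<And>c P. g (lie_scale c P) = scale c (g P)"
    and brk: "\<And>P Q. g (lie_bracket P Q) = bracket (g P) (g Q)"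
  shows "g = free_lie_lift scale bracket f"
proof
  fix P
  interpret additive g by unfold_locales (rule add)
  have "g (abs_free_lie t) = lie_term_eval scale bracket f t" for t
    by (induction t)
      (simp_all add: var add scl brk zero minus lie_var.abs_eq[symmetric]
        zero_free_lie.abs_eq[symmetric] plus_free_lie.abs_eq[symmetric]
        uminus_free_lie.abs_eq[symmetric] lie_scale.abs_eq[symmetric]
        lie_bracket.abs_eq[symmetric])
  then show "g P = free_lie_lift scale bracket f P"
    by (induction P) (simp add: free_lie_lift_abs)
qed

end


subsection \<open>Homogeneity and iterated commutators\<close>

inductive lie_monomial :: "nat \<Rightarrow> ('k::comm_ring_1, 'x) free_lie \<Rightarrow> bool" where
  "lie_monomial 1 (lie_var x)"
| "lie_monomial p M \<Longrightarrow> lie_monomial q N \<Longrightarrow> lie_monomial (p + q) (lie_bracket M N)"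

definition lie_homogeneous :: "nat \<Rightarrow> ('k::comm_ring_1, 'x) free_lie \<Rightarrow> bool" where
  "lie_homogeneous h P \<longleftrightarrow> P \<in> module.span lie_scale {M. lie_monomial h M}"

text \<open>\<open>lie_comm_L [Y\<^sub>1, \<dots>, Y\<^sub>p] = [Y\<^sub>1, [Y\<^sub>2, \<dots> [Y\<^sub>p\<^sub>-\<^sub>1, Y\<^sub>p] \<dots>]]\<close> and
  \<open>lie_comm_R [Y\<^sub>1, \<dots>, Y\<^sub>p] = [[\<dots> [Y\<^sub>1, Y\<^sub>2], \<dots>, Y\<^sub>p\<^sub>-\<^sub>1], Y\<^sub>p]\<close>; the values at the empty list are
  dummies.\<close>

fun lie_comm_L :: "('k::comm_ring_1, 'x) free_lie list \<Rightarrow> ('k, 'x) free_lie" where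
  "lie_comm_L [] = 0"
| "lie_comm_L [Y] = Y"
| "lie_comm_L (Y # Z # Ys) = lie_bracket Y (lie_comm_L (Z # Ys))"

fun lie_comm_R :: "('k::comm_ring_1, 'x) free_lie list \<Rightarrow> ('k, 'x) free_lie" where
  "lie_comm_R [] = 0"
| "lie_comm_R (Y # Ys) = foldl lie_bracket Y Ys"


section \<open>The free associative unital algebra\<close>

text \<open>The monoid algebra of the free monoid. Words are wrapped in a type of their own because the
  convolution product on \<^typ>\<open>'a \<Rightarrow>\<^sub>0 'b\<close> needs an additively written monoid of exponents, here
  concatenation of words.\<close>

datatype 'x word = Word (letters: "'x list")

instantiation word :: (type) monoid_add
begin

definition zero_word :: "'a word" where "0 = Word []"

definition plus_word :: "'a word \<Rightarrow> 'a word \<Rightarrow> 'a word"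
  where "u + v = Word (letters u @ letters v)"

instance
  by standard (simp_all add: zero_word_def plus_word_def)

end

type_synonym ('k, 'x) free_assoc = "'x word \<Rightarrow>\<^sub>0 'k"

definition assoc_var :: "'x \<Rightarrow> ('k::comm_ring_1, 'x) free_assoc" where
  "assoc_var x = Poly_Mapping.single (Word [x]) 1"

definition assoc_scale :: "'k::comm_ring_1 \<Rightarrow> ('k, 'x) free_assoc \<Rightarrow> ('k, 'x) free_assoc" where
  "assoc_scale c p = Poly_Mapping.map ((*) c) p"

definition commutator :: "'r::ring \<Rightarrow> 'r \<Rightarrow> 'r" where
  "commutator a b = a * b - b * a"

lemma assoc_scale_conv_single: "assoc_scale c p = Poly_Mapping.single 0 c * p"
  by (simp add: assoc_scale_def mult_map_scale_conv_mult)

lemma lookup_assoc_scale: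
  "Poly_Mapping.lookup (assoc_scale c p) w = c * Poly_Mapping.lookup p w"
  by (simp add: assoc_scale_def Poly_Mapping.map.rep_eq when_def)

lemma assoc_scale_mult_left: "assoc_scale c (p * q) = assoc_scale c p * q"
  by (simp add: assoc_scale_conv_single mult.assoc)

lemma single_zero_mult_commute:
  "Poly_Mapping.single 0 c * p = p * Poly_Mapping.single 0 c"
  for c :: "'k::comm_ring_1" and p :: "('k, 'x) free_assoc"
proof (induction p rule: update_induct)
  case const
  show ?case by simp
next
  case (update p w a)
  have "Poly_Mapping.update w a p = p + Poly_Mapping.single w a"
    using update.hyps
    by (intro poly_mapping_eqI)
      (auto simp: lookup_update lookup_add lookup_single in_keys_iff when_def)
  then show ?case
    using update.IH by (simp add: algebra_simps mult_single)
qed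

lemma assoc_scale_mult_right: "assoc_scale c (p * q) = p * assoc_scale c q"
  by (metis assoc_scale_conv_single mult.assoc single_zero_mult_commute)

interpretation free_assoc: lie_algebra assoc_scale commutator
proof unfold_locales
  fix c d :: "'k::comm_ring_1" and x y z :: "('k, 'x) free_assoc"
  show *: "assoc_scale c (x + y) = assoc_scale c x + assoc_scale c y" for c x y
    by (simp add: assoc_scale_conv_single distrib_left)
  show "assoc_scale (c + d) x = assoc_scale c x + assoc_scale d x"
    by (simp add: assoc_scale_conv_single single_add distrib_right)
  show "assoc_scale c (assoc_scale d x) = assoc_scale (c * d) x"
    by (simp add: assoc_scale_conv_single mult_single mult.assoc[symmetric])
  show "assoc_scale 1 x = x"
    by (simp add: assoc_scale_conv_single)
  have diff: "assoc_scale c (x - y) = assoc_scale c x - assoc_scale c y" for x y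
    by (simp add: assoc_scale_conv_single right_diff_distrib)
  show "commutator (x + y) z = commutator x z + commutator y z"
    by (simp add: commutator_def algebra_simps)
  show "commutator x (y + z) = commutator x y + commutator x z"
    by (simp add: commutator_def algebra_simps)
  show "commutator (assoc_scale c x) y = assoc_scale c (commutator x y)"
    by (simp add: commutator_def diff assoc_scale_mult_left[symmetric]
        assoc_scale_mult_right[symmetric])
  show "commutator x (assoc_scale c y) = assoc_scale c (commutator x y)"
    by (simp add: commutator_def diff assoc_scale_mult_left[symmetric]
        assoc_scale_mult_right[symmetric])
  show "commutator x x = 0"
    by (simp add: commutator_def)
  show "commutator x (commutator y z) + commutator y (commutator z x)
          + commutator z (commutator x y) = 0"
    by (simp add: commutator_def algebra_simps)
qed

definition commutator_eval :: "('k::comm_ring_1, 'x) free_lie \<Rightarrow> ('k, 'x) free_assoc" where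
  "commutator_eval = free_lie_lift assoc_scale commutator assoc_var"

end

theory Submission
  imports Defs
begin

text \<open>Extend \<open>L w = [w]\<^sub>L\<close>, \<open>R w = [w]\<^sub>R\<close> and \<open>T w = \<Sum>\<^sub>p [L w\<^sub>1\<dots>w\<^sub>p, R w\<^sub>p\<^sub>+\<^sub>1\<dots>w\<^sub>h]\<close> linearly from words
  to the free associative algebra.  That algebra acts on the free Lie algebra from either side by
  iterated brackets, and a Lie polynomial acts by bracketing with it.  Hence \<open>L\<close> and \<open>R\<close> are derivations on
  Lie polynomials and multiply degree \<open>h\<close> by \<open>h\<close> (Dynkin--Specht--Wever), while splitting the
  concatenation \<open>P Q\<close> before, at and after the join gives
  \<open>T [P, Q] = [T P, Q] + [P, T Q] + [L P, R Q] - [L Q, R P]\<close>.  For degrees \<open>p\<close>, \<open>q\<close> the factors add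
  up to \<open>p (p - 1) + q (q - 1) + 2 p q = (p + q) (p + q - 1)\<close>.\<close>

section \<open>Linear extension from a basis\<close>

lemma poly_mapping_add_induct:
  fixes p :: "'w \<Rightarrow>\<^sub>0 'c::comm_monoid_add"
  assumes "Q 0" "\<And>p w c. Q p \<Longrightarrow> Q (Poly_Mapping.single w c) \<Longrightarrow> Q (p + Poly_Mapping.single w c)"
    and "\<And>w c. Q (Poly_Mapping.single w c)"
  shows "Q p"
proof (induction p rule: update_induct)
  case const
  show ?case by (rule assms)
next
  case (update p w a)
  have "Poly_Mapping.update w a p = p + Poly_Mapping.single w a"
    using update.hyps
    by (intro poly_mapping_eqI)
      (auto simp: lookup_update lookup_add lookup_single in_keys_iff when_def)
  then show ?case using update.IH assms by simp
qed

context lie_algebra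
begin

definition lin_ext :: "('w \<Rightarrow> 'b) \<Rightarrow> ('w \<Rightarrow>\<^sub>0 'k) \<Rightarrow> 'b" where
  "lin_ext f p = (\<Sum>w\<in>Poly_Mapping.keys p. scale (Poly_Mapping.lookup p w) (f w))"

lemma lin_ext_superset:
  fixes p :: "'w \<Rightarrow>\<^sub>0 'k"
  assumes "finite A" "Poly_Mapping.keys p \<subseteq> A"
  shows "lin_ext f p = (\<Sum>w\<in>A. scale (Poly_Mapping.lookup p w) (f w))"
  unfolding lin_ext_def using assms by (intro sum.mono_neutral_left) (auto simp: in_keys_iff)

lemma lin_ext_add: "lin_ext f (p + q) = lin_ext f p + lin_ext f q"
proof -
  let ?A = "Poly_Mapping.keys p \<union> Poly_Mapping.keys q"
  have "Poly_Mapping.keys (p + q) \<subseteq> ?A" by (rule Poly_Mapping.keys_add)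
  then show ?thesis
    by (simp add: lin_ext_superset[where A = ?A] lookup_add scale_left_distrib sum.distrib)
qed

lemma lin_ext_zero [simp]: "lin_ext f 0 = 0"
  by (simp add: lin_ext_def)

lemma lin_ext_diff: "lin_ext f (p - q) = lin_ext f p - lin_ext f q"
  using lin_ext_add[of f "p - q" q] by simp

lemma lin_ext_sum: "lin_ext f (\<Sum>s\<in>S. p s) = (\<Sum>s\<in>S. lin_ext f (p s))"
  by (induction S rule: infinite_finite_induct) (simp_all add: lin_ext_add)

lemma lin_ext_single [simp]: "lin_ext f (Poly_Mapping.single w c) = scale c (f w)"
  by (subst lin_ext_superset[where A = "{w}"]) simp_all

lemma lin_ext_cong:
  "(\<And>w. w \<in> Poly_Mapping.keys p \<Longrightarrow> f w = g w) \<Longrightarrow> lin_ext f p = lin_ext g p"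
  by (simp add: lin_ext_def)

lemma lin_ext_fun_add: "lin_ext (\<lambda>w. f w + g w) p = lin_ext f p + lin_ext g p"
  by (simp add: lin_ext_def scale_right_distrib sum.distrib)

lemma lin_ext_fun_diff: "lin_ext (\<lambda>w. f w - g w) p = lin_ext f p - lin_ext g p"
  by (simp add: lin_ext_def scale_right_diff_distrib sum_subtractf)

lemma lin_ext_fun_sum: "lin_ext (\<lambda>w. \<Sum>s\<in>S. f s w) p = (\<Sum>s\<in>S. lin_ext (f s) p)"
  unfolding lin_ext_def scale_sum_right by (rule sum.swap)

lemma lin_ext_swap:
  "lin_ext (\<lambda>u. lin_ext (\<lambda>v. f u v) q) p = lin_ext (\<lambda>v. lin_ext (\<lambda>u. f u v) p) q"
  unfolding lin_ext_def scale_sum_right by (subst sum.swap) (simp add: mult.commute)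

text \<open>Both sides are additive in \<open>p\<close> and in \<open>q\<close>, which leaves two
  single basis elements. This turns products of expansions into concatenations of words.\<close>

lemma lin_ext_mult:
  fixes p q :: "'w::monoid_add \<Rightarrow>\<^sub>0 'k"
  shows "lin_ext f (p * q) = lin_ext (\<lambda>u. lin_ext (\<lambda>v. f (u + v)) q) p"
proof (induction p rule: poly_mapping_add_induct)
  case (3 u c)
  show ?case
    by (induction q rule: poly_mapping_add_induct)
      (simp_all add: distrib_left lin_ext_add mult_single scale_right_distrib)
qed (simp_all add: distrib_right lin_ext_add)

section \<open>Identities for the bracket\<close>

lemma bracket_zero_left [simp]: "bracket 0 y = 0"
  using bracket_add_left[of 0 0 y] by simp

lemma bracket_zero_right [simp]: "bracket y 0 = 0"
  using bracket_add_right[of y 0 0] by simp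

lemma bracket_skew: "bracket y x = - bracket x y"
  using bracket_self[of "x + y"]
  by (simp add: bracket_add_left bracket_add_right bracket_self[of x] bracket_self[of y]
      eq_neg_iff_add_eq_0 add.commute)

lemma bracket_uminus_left: "bracket (- x) y = - bracket x y"
  using bracket_add_left[of "- x" x y] by (simp add: eq_neg_iff_add_eq_0)

lemma bracket_uminus_right: "bracket x (- y) = - bracket x y"
  using bracket_add_right[of x "- y" y] by (simp add: eq_neg_iff_add_eq_0)

text \<open>The Jacobi identity in the form used below: ad of \<open>bracket x y\<close> is the
  commutator of ad \<open>x\<close> and ad \<open>y\<close>.\<close>

lemma bracket_derivation_left:
  "bracket x (bracket y z) = bracket (bracket x y) z + bracket y (bracket x z)"
  using jacobi[of x y z] bracket_skew[of z "bracket x y"] bracket_skew[of z x]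
  by (simp add: bracket_uminus_right algebra_simps)

lemma bracket_derivation_right:
  "bracket (bracket x y) z = bracket (bracket x z) y + bracket x (bracket y z)"
  using bracket_derivation_left[of x y z] bracket_skew[of "bracket x z" y] by simp

lemma bracket_sum_left: "bracket (\<Sum>s\<in>S. f s) y = (\<Sum>s\<in>S. bracket (f s) y)"
  by (induction S rule: infinite_finite_induct) (simp_all add: bracket_add_left)

lemma bracket_sum_right: "bracket y (\<Sum>s\<in>S. f s) = (\<Sum>s\<in>S. bracket y (f s))"
  by (induction S rule: infinite_finite_induct) (simp_all add: bracket_add_right)

lemma bracket_lin_ext_left: "bracket (lin_ext f p) y = lin_ext (\<lambda>w. bracket (f w) y) p"
  by (simp add: lin_ext_def bracket_sum_left bracket_scale_left)

lemma bracket_lin_ext_right: "bracket y (lin_ext f p) = lin_ext (\<lambda>w. bracket y (f w)) p"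
  by (simp add: lin_ext_def bracket_sum_right bracket_scale_right)

end

section \<open>Iterated brackets along words\<close>

lemma letters_add [simp]: "letters (u + v) = letters u @ letters v"
  by (simp add: plus_word_def)

text \<open>The left module structure on the free Lie algebra in which a generator acts by
  bracketing from the left; the empty word acts as the identity. \<open>ad_right\<close> is the
  corresponding right module structure.\<close>

definition ad_left :: "'x list \<Rightarrow> ('k::comm_ring_1, 'x) free_lie \<Rightarrow> ('k, 'x) free_lie" where
  "ad_left w y = foldr (\<lambda>x. lie_bracket (lie_var x)) w y"

definition ad_right :: "('k::comm_ring_1, 'x) free_lie \<Rightarrow> 'x list \<Rightarrow> ('k, 'x) free_lie" where
  "ad_right y w = foldl (\<lambda>z x. lie_bracket z (lie_var x)) y w"

definition word_L :: "'x list \<Rightarrow> ('k::comm_ring_1, 'x) free_lie" where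
  "word_L w = lie_comm_L (map lie_var w)"

definition word_R :: "'x list \<Rightarrow> ('k::comm_ring_1, 'x) free_lie" where
  "word_R w = lie_comm_R (map lie_var w)"

text \<open>The operator \<open>T\<close> on a single word. Only cuts into two nonempty pieces are
  summed, so the dummy values at the empty list never enter.\<close>

definition word_LR :: "'x list \<Rightarrow> ('k::comm_ring_1, 'x) free_lie" where
  "word_LR w = (\<Sum>p=1..<length w. lie_bracket (word_L (take p w)) (word_R (drop p w)))"

lemma ad_left_append: "ad_left (u @ v) y = ad_left u (ad_left v y)"
  by (simp add: ad_left_def)

lemma ad_right_append: "ad_right y (u @ v) = ad_right (ad_right y u) v"
  by (simp add: ad_right_def)

text \<open>The innermost bracket lies in \<open>v\<close>, and the letters of \<open>u\<close> only
  wrap it from outside. An empty \<open>v\<close> is excluded because \<open>word_L []\<close> is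
  the dummy 0.\<close>

lemma word_L_append: "v \<noteq> [] \<Longrightarrow> word_L (u @ v) = ad_left u (word_L v)"
proof (induction u)
  case (Cons x u)
  then obtain y w where "u @ v = y # w" by (cases "u @ v") auto
  then show ?case using Cons by (simp add: word_L_def ad_left_def)
qed (simp add: ad_left_def)

lemma word_R_append: "u \<noteq> [] \<Longrightarrow> word_R (u @ v) = ad_right (word_R u) v"
  by (cases u) (simp_all add: word_R_def ad_right_def foldl_map)

lemma word_LR_append:
  assumes "u \<noteq> []" "v \<noteq> []"
  shows "word_LR (u @ v) =
    (\<Sum>p=1..<length u. lie_bracket (word_L (take p u)) (ad_right (word_R (drop p u)) v))
    + lie_bracket (word_L u) (word_R v)
    + (\<Sum>p=1..<length v. lie_bracket (ad_left u (word_L (take p v))) (word_R (drop p v)))"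
proof -
  let ?g = "\<lambda>p. lie_bracket (word_L (take p (u @ v))) (word_R (drop p (u @ v)))"
  have "word_LR (u @ v) = (\<Sum>p=1..<length u. ?g p) + (\<Sum>p=length u..<length u + length v. ?g p)"
    unfolding word_LR_def using assms
    by (subst sum.atLeastLessThan_concat) (simp_all add: Suc_le_eq)
  also have "(\<Sum>p=length u..<length u + length v. ?g p) = (\<Sum>p=0..<length v. ?g (p + length u))"
    using sum.shift_bounds_nat_ivl[of ?g 0 "length u" "length v"] by (simp add: add.commute)
  \<comment> \<open>Index 0 is the cut exactly at the join. It is split off because the later cuts
    go through \<open>word_L_append\<close>, which requires \<open>take p v\<close> to be
    nonempty.\<close>
  also have "\<dots> = ?g (length u) + (\<Sum>p=1..<length v. ?g (p + length u))"
    using assms by (subst sum.atLeast_Suc_lessThan) simp_all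
  also have "(\<Sum>p=1..<length v. ?g (p + length u)) =
      (\<Sum>p=1..<length v. lie_bracket (ad_left u (word_L (take p v))) (word_R (drop p v)))"
    using assms by (intro sum.cong) (auto simp: word_L_append)
  also have "(\<Sum>p=1..<length u. ?g p) =
      (\<Sum>p=1..<length u. lie_bracket (word_L (take p u)) (ad_right (word_R (drop p u)) v))"
    by (intro sum.cong) (auto simp: word_R_append)
  finally show ?thesis by (simp add: add.assoc)
qed

lemma ad_left_lin_ext: "ad_left u (free_lie.lin_ext f p) = free_lie.lin_ext (\<lambda>w. ad_left u (f w)) p"
  by (induction u) (simp_all add: ad_left_def free_lie.bracket_lin_ext_right)

section \<open>Expansions of Lie monomials and their action\<close>

lemma commutator_eval_var: "commutator_eval (lie_var x) = assoc_var x"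
  by (simp add: commutator_eval_def free_assoc.free_lie_lift_var)

lemma commutator_eval_bracket:
  "commutator_eval (lie_bracket P Q) =
     commutator_eval P * commutator_eval Q - commutator_eval Q * commutator_eval P"
  by (simp add: commutator_eval_def free_assoc.free_lie_lift_bracket commutator_def)

text \<open>Supplies the nonemptiness conditions of the append lemmas: generators have words of
  length one, and the words of a commutator are concatenations of words of its two factors.\<close>

lemma letters_keys_commutator_eval:
  assumes "lie_monomial n M" "w \<in> Poly_Mapping.keys (commutator_eval M)"
  shows "letters w \<noteq> []"
  using assms
proof (induction arbitrary: w rule: lie_monomial.induct)
  case (1 x)
  then show ?case
    by (auto simp: commutator_eval_var assoc_var_def split: if_splits)
next
  case (2 p M q N)
  let ?a = "commutator_eval M" and ?b = "commutator_eval N"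
  have "w \<in> Poly_Mapping.keys (?a * ?b) \<union> Poly_Mapping.keys (?b * ?a)"
    using 2(5) keys_diff[of "?a * ?b" "?b * ?a"] unfolding commutator_eval_bracket by auto
  then show ?case
    using keys_mult[of ?a ?b] keys_mult[of ?b ?a] 2 by fastforce
qed

lemma lie_monomial_degree_pos: "lie_monomial n M \<Longrightarrow> n > 0"
  by (induction rule: lie_monomial.induct) auto

text \<open>Products act by composition, so the expansion of \<open>lie_bracket M N\<close> acts as
  the commutator of ad \<open>M\<close> and ad \<open>N\<close>, which is ad of the bracket by
  Jacobi.\<close>

lemma lin_ext_ad_left:
  assumes "lie_monomial n M"
  shows "free_lie.lin_ext (\<lambda>w. ad_left (letters w) y) (commutator_eval M) = lie_bracket M y"
  using assms
proof (induction arbitrary: y rule: lie_monomial.induct)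
  case (1 x)
  then show ?case
    by (simp add: commutator_eval_var assoc_var_def ad_left_def)
next
  case (2 p M q N)
  then show ?case
    using free_lie.bracket_derivation_left[of M N y]
    by (simp add: commutator_eval_bracket free_lie.lin_ext_diff free_lie.lin_ext_mult
        ad_left_append ad_left_lin_ext[symmetric])
qed

lemma lin_ext_ad_right:
  assumes "lie_monomial n M"
  shows "free_lie.lin_ext (\<lambda>w. ad_right y (letters w)) (commutator_eval M) = lie_bracket y M"
  using assms
proof (induction arbitrary: y rule: lie_monomial.induct)
  case (1 x)
  then show ?case
    by (simp add: commutator_eval_var assoc_var_def ad_right_def)
next
  case (2 p M q N)
  \<comment> \<open>Stated for general \<open>A\<close> and \<open>B\<close> since the commutator
    contains both orders. A right action applies \<open>A\<close> first, then
    \<open>B\<close>.\<close>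
  have *: "free_lie.lin_ext (\<lambda>w. ad_right y (letters w)) (commutator_eval A * commutator_eval B)
      = lie_bracket (lie_bracket y A) B"
    if "\<And>y. free_lie.lin_ext (\<lambda>w. ad_right y (letters w)) (commutator_eval A) = lie_bracket y A"
      "\<And>y. free_lie.lin_ext (\<lambda>w. ad_right y (letters w)) (commutator_eval B) = lie_bracket y B"
    for A B
    by (simp add: free_lie.lin_ext_mult ad_right_append that
        flip: free_lie.bracket_lin_ext_left)
  show ?case
    using free_lie.bracket_derivation_right[of y M N]
    by (simp add: commutator_eval_bracket free_lie.lin_ext_diff * 2)
qed

section \<open>Dynkin--Specht--Wever identities and the operator \<open>T\<close> on Lie
  monomials\<close>

lemma lin_ext_word_L:
  assumes "lie_monomial n M"
  shows "free_lie.lin_ext (\<lambda>w. word_L (letters w)) (commutator_eval M) = lie_scale (of_nat n) M"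
  using assms
proof (induction rule: lie_monomial.induct)
  case (1 x)
  then show ?case
    by (simp add: commutator_eval_var assoc_var_def word_L_def)
next
  case (2 p M q N)
  \<comment> \<open>The words of \<open>A\<close> wrap those of \<open>B\<close>, so they act
    together as ad \<open>A\<close>. Hence L of the bracket is [M, L N] - [N, L M], and skew
    symmetry adds the degrees \<open>q\<close> and \<open>p\<close>.\<close>
  have *: "free_lie.lin_ext (\<lambda>w. word_L (letters w)) (commutator_eval A * commutator_eval B)
      = lie_bracket A (free_lie.lin_ext (\<lambda>w. word_L (letters w)) (commutator_eval B))"
    if "lie_monomial a A" "lie_monomial b B"
    for A B :: "('a, 'b) free_lie" and a b
  proof -
    have "free_lie.lin_ext (\<lambda>w. word_L (letters w)) (commutator_eval A * commutator_eval B)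
      = free_lie.lin_ext (\<lambda>u. free_lie.lin_ext (\<lambda>v. ad_left (letters u) (word_L (letters v)))
          (commutator_eval B)) (commutator_eval A)"
      unfolding free_lie.lin_ext_mult letters_add
      by (intro free_lie.lin_ext_cong word_L_append letters_keys_commutator_eval[OF that(2)])
    then show ?thesis
      by (simp add: lin_ext_ad_left[OF that(1)] flip: ad_left_lin_ext)
  qed
  show ?case
    using free_lie.bracket_skew[of N M]
    by (simp add: commutator_eval_bracket free_lie.lin_ext_diff *[OF 2(1,2)] *[OF 2(2,1)] 2
        free_lie.bracket_scale_right free_lie.scale_left_distrib add.commute)
qed

text \<open>Mirror image of the previous identity: the second factor now acts from the right, giving
  [R M, N] - [R N, M].\<close>

lemma lin_ext_word_R:
  assumes "lie_monomial n M"
  shows "free_lie.lin_ext (\<lambda>w. word_R (letters w)) (commutator_eval M) = lie_scale (of_nat n) M"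
  using assms
proof (induction rule: lie_monomial.induct)
  case (1 x)
  then show ?case
    by (simp add: commutator_eval_var assoc_var_def word_R_def)
next
  case (2 p M q N)
  have *: "free_lie.lin_ext (\<lambda>w. word_R (letters w)) (commutator_eval A * commutator_eval B)
      = lie_bracket (free_lie.lin_ext (\<lambda>w. word_R (letters w)) (commutator_eval A)) B"
    if "lie_monomial a A" "lie_monomial b B"
    for A B :: "('a, 'b) free_lie" and a b
  proof -
    have "free_lie.lin_ext (\<lambda>w. word_R (letters w)) (commutator_eval A * commutator_eval B)
      = free_lie.lin_ext (\<lambda>u. free_lie.lin_ext (\<lambda>v. ad_right (word_R (letters u)) (letters v))
          (commutator_eval B)) (commutator_eval A)"
      unfolding free_lie.lin_ext_mult letters_add
      by (intro free_lie.lin_ext_cong word_R_append letters_keys_commutator_eval[OF that(1)])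
    then show ?thesis
      by (simp add: lin_ext_ad_right[OF that(2)] free_lie.bracket_lin_ext_left)
  qed
  show ?case
    using free_lie.bracket_skew[of N M]
    by (simp add: commutator_eval_bracket free_lie.lin_ext_diff *[OF 2(1,2)] *[OF 2(2,1)] 2
        free_lie.bracket_scale_left free_lie.scale_left_distrib)
qed

text \<open>The three terms are the cuts inside \<open>M\<close>, at the join and inside
  \<open>N\<close>. A factor that is not cut acts as a whole by bracketing, and at the join the two
  Dynkin identities contribute the degrees.\<close>

lemma lin_ext_word_LR_mult:
  assumes M: "lie_monomial m M" and N: "lie_monomial n N"
  shows "free_lie.lin_ext (\<lambda>w. word_LR (letters w)) (commutator_eval M * commutator_eval N) =
    free_lie.lin_ext (\<lambda>w. \<Sum>p=1..<length (letters w).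
      lie_bracket (word_L (take p (letters w))) (lie_bracket (word_R (drop p (letters w))) N))
      (commutator_eval M)
    + lie_bracket (lie_scale (of_nat m) M) (lie_scale (of_nat n) N)
    + free_lie.lin_ext (\<lambda>w. \<Sum>p=1..<length (letters w).
      lie_bracket (lie_bracket M (word_L (take p (letters w)))) (word_R (drop p (letters w))))
      (commutator_eval N)"
    (is "_ = free_lie.lin_ext ?F ?a + ?B + free_lie.lin_ext ?G ?b")
proof -
  let ?F' = "\<lambda>u v. \<Sum>p=1..<length (letters u).
      lie_bracket (word_L (take p (letters u))) (ad_right (word_R (drop p (letters u))) (letters v))"
  let ?G' = "\<lambda>u v. \<Sum>p=1..<length (letters v).
      lie_bracket (ad_left (letters u) (word_L (take p (letters v)))) (word_R (drop p (letters v)))"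
  let ?B' = "\<lambda>u v. lie_bracket (word_L (letters u)) (word_R (letters v))"
  let ?E = "\<lambda>H. free_lie.lin_ext (\<lambda>u. free_lie.lin_ext (\<lambda>v. H u v) ?b) ?a"
  have "free_lie.lin_ext (\<lambda>w. word_LR (letters w)) (?a * ?b) = ?E (\<lambda>u v. ?F' u v + ?B' u v + ?G' u v)"
    unfolding free_lie.lin_ext_mult letters_add
    by (intro free_lie.lin_ext_cong word_LR_append letters_keys_commutator_eval[OF M]
        letters_keys_commutator_eval[OF N])
  also have "\<dots> = ?E ?F' + ?E ?B' + ?E ?G'"
    by (simp only: free_lie.lin_ext_fun_add)
  also have "?E ?F' = free_lie.lin_ext ?F ?a"
    by (simp add: free_lie.lin_ext_fun_sum lin_ext_ad_right[OF N]
        flip: free_lie.bracket_lin_ext_right)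
  also have "?E ?B' = ?B"
    by (simp add: lin_ext_word_L[OF M] lin_ext_word_R[OF N]
        flip: free_lie.bracket_lin_ext_right free_lie.bracket_lin_ext_left)
  \<comment> \<open>The sums are swapped so that, for a fixed word \<open>v\<close> of
    \<open>N\<close>, the inner sum over the words of \<open>M\<close> collapses to bracketing with
    \<open>M\<close>.\<close>
  also have "?E ?G' = free_lie.lin_ext ?G ?b"
    by (subst free_lie.lin_ext_swap)
      (simp add: free_lie.lin_ext_fun_sum lin_ext_ad_left[OF M]
        flip: free_lie.bracket_lin_ext_left)
  finally show ?thesis .
qed

lemma lin_ext_word_LR:
  assumes "lie_monomial n M"
  shows "free_lie.lin_ext (\<lambda>w. word_LR (letters w)) (commutator_eval M)
    = lie_scale (of_nat (n * (n - 1))) M"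
  using assms
proof (induction rule: lie_monomial.induct)
  case (1 x)
  then show ?case
    by (simp add: commutator_eval_var assoc_var_def word_LR_def)
next
  case (2 m M n N)
  let ?LR = "\<lambda>P. free_lie.lin_ext (\<lambda>w. word_LR (letters w)) (commutator_eval P)"
  let ?mid = "lie_bracket (lie_scale (of_nat m) M) (lie_scale (of_nat n) N)"
  let ?mid' = "lie_bracket (lie_scale (of_nat n) N) (lie_scale (of_nat m) M)"
  \<comment> \<open>A cut of a word of \<open>M\<close> into pieces with values \<open>l\<close> and
    \<open>r\<close> contributes the first term through the product M N and the second through N M;
    \<open>right\<close> treats the cuts inside \<open>N\<close> likewise.\<close>
  have left: "lie_bracket l (lie_bracket r N) - lie_bracket (lie_bracket N l) r
      = lie_bracket (lie_bracket l r) N" for l r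
    using free_lie.bracket_derivation_right[of l r N] free_lie.bracket_skew[of N l]
    by (simp add: free_lie.bracket_uminus_left)
  have right: "lie_bracket (lie_bracket M l) r - lie_bracket l (lie_bracket r M)
      = lie_bracket M (lie_bracket l r)" for l r
    using free_lie.bracket_derivation_left[of M l r] free_lie.bracket_skew[of r M]
    by (simp add: free_lie.bracket_uminus_right)
  have "?LR (lie_bracket M N) = lie_bracket (?LR M) N + (?mid - ?mid') + lie_bracket M (?LR N)"
    unfolding commutator_eval_bracket free_lie.lin_ext_diff
      lin_ext_word_LR_mult[OF 2(1,2)] lin_ext_word_LR_mult[OF 2(2,1)]
    \<comment> \<open>\<open>left\<close> and \<open>right\<close> are used backwards: each summand
      of [T M, N] and [M, T N] is expanded, after which only additive rearrangement remains.\<close>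
    unfolding free_lie.bracket_lin_ext_left free_lie.bracket_lin_ext_right word_LR_def
      free_lie.bracket_sum_left free_lie.bracket_sum_right left[symmetric] right[symmetric]
      sum_subtractf free_lie.lin_ext_fun_diff
    by (simp add: algebra_simps)
  also have "?mid - ?mid' = lie_scale (of_nat (m * n + m * n)) (lie_bracket M N)"
    unfolding free_lie.bracket_scale_left free_lie.bracket_scale_right free_lie.bracket_skew[of N M]
      of_nat_add of_nat_mult free_lie.scale_left_distrib
    by (simp add: mult.commute)
  also have "lie_bracket (?LR M) N + lie_scale (of_nat (m * n + m * n)) (lie_bracket M N)
      + lie_bracket M (?LR N)
    = lie_scale (of_nat (m * (m - 1) + (m * n + m * n) + n * (n - 1))) (lie_bracket M N)"
    by (simp only: 2 of_nat_add free_lie.scale_left_distrib free_lie.bracket_scale_left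
        free_lie.bracket_scale_right)
  \<comment> \<open>Writing the positive degrees as successors removes the truncated
    subtractions.\<close>
  also have "m * (m - 1) + (m * n + m * n) + n * (n - 1) = (m + n) * (m + n - 1)"
    using lie_monomial_degree_pos[OF 2(1)] lie_monomial_degree_pos[OF 2(2)]
    by (cases m; cases n) (simp_all add: algebra_simps)
  finally show ?case .
qed

section \<open>From monomials to homogeneous elements\<close>

lemma lin_ext_assoc_scale:
  "free_lie.lin_ext f (assoc_scale c p) = lie_scale c (free_lie.lin_ext f p)"
  by (simp add: assoc_scale_conv_single free_lie.lin_ext_mult)

lemma prod_list_assoc_var:
  "prod_list (map assoc_var xs) = Poly_Mapping.single (Word xs) 1"
  by (induction xs) (simp_all add: assoc_var_def mult_single plus_word_def flip: zero_word_def)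

text \<open>Both sides are linear in \<open>P\<close>, and the monomials of degree \<open>h\<close>
  span the homogeneous elements of degree \<open>h\<close>.\<close>

lemma lin_ext_word_LR_homogeneous:
  assumes "lie_homogeneous h P"
  shows "free_lie.lin_ext (\<lambda>w. word_LR (letters w)) (commutator_eval P)
    = lie_scale (of_nat (h * (h - 1))) P"
  using assms unfolding lie_homogeneous_def
proof (induction rule: free_lie.span_induct_alt)
  case base
  have "commutator_eval 0 = (0 :: ('a, 'b) free_assoc)"
    using free_assoc.free_lie_lift_add[of assoc_var 0 "0 :: ('a, 'b) free_lie"]
    by (simp add: commutator_eval_def)
  then show ?case by simp
next
  case (step c M P)
  then show ?case
    by (simp add: commutator_eval_def free_assoc.free_lie_lift_add free_assoc.free_lie_lift_scale
        free_lie.lin_ext_add lin_ext_assoc_scale lin_ext_word_LR[unfolded commutator_eval_def]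
        free_lie.scale_right_distrib mult.commute)
qed

theorem theorem2p1:
  fixes P :: "('k::comm_ring_1, 'n::finite) free_lie"
    and h :: nat
    and S :: "'s set"
    and a :: "'s \<Rightarrow> 'k"
    and i :: "'s \<Rightarrow> nat \<Rightarrow> 'n"
  assumes "lie_homogeneous h P"
    and "finite S"
    and "commutator_eval P =
           (\<Sum>s\<in>S. assoc_scale (a s) (prod_list (map (\<lambda>j. assoc_var (i s j)) [1..<h+1])))"
  shows "lie_scale (of_nat (h * (h - 1))) P =
           (\<Sum>s\<in>S. \<Sum>p=1..h-1. lie_scale (a s)
              (lie_bracket
                (lie_comm_L (map (\<lambda>j. lie_var (i s j)) [1..<p+1]))
                (lie_comm_R (map (\<lambda>j. lie_var (i s j)) [p+1..<h+1]))))"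
proof -
  \<comment> \<open>Letters are numbered from 1, and the ranges \<open>1..<h\<close> and
    \<open>1..h-1\<close> of cuts agree, both being empty for \<open>h = 0\<close>.\<close>
  have word: "word_LR (map (i s) [1..<h+1]) = (\<Sum>p=1..h-1. lie_bracket
      (lie_comm_L (map (\<lambda>j. lie_var (i s j)) [1..<p+1]))
      (lie_comm_R (map (\<lambda>j. lie_var (i s j)) [p+1..<h+1])))" for s
    unfolding word_LR_def word_L_def word_R_def
    by (intro sum.cong) (auto simp: take_map drop_map comp_def simp del: upt_Suc)
  have "lie_scale (of_nat (h * (h - 1))) P
      = free_lie.lin_ext (\<lambda>w. word_LR (letters w)) (commutator_eval P)"
    using lin_ext_word_LR_homogeneous[OF assms(1)] by simp
  \<comment> \<open>Linearity of \<open>T\<close> applies to the expansion exactly as given, so the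
    same word may occur for several \<open>s\<close>.\<close>
  also have "\<dots> = (\<Sum>s\<in>S. lie_scale (a s) (word_LR (map (i s) [1..<h+1])))"
    by (simp add: assms(3) free_lie.lin_ext_sum lin_ext_assoc_scale
        prod_list_assoc_var[of "map (i _) _", unfolded map_map comp_def] del: upt_Suc)
  finally show ?thesis
    unfolding word free_lie.scale_sum_right .
qed

end
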